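(* Let $N\ge2$, $0<g_1<\cdots<g_N$, $f_{ij}=g_i+g_j$ for $i\ne j$, and let $y\in\mathcal S^\circ=\{y\in(0,1)^N:\sum_iy_i=1\}$. For every $j=1,\dots,N-1$, $$B(y)^{\sf T}\nabla_yz_j=-\lambda_j(y)\nabla_yz_j,\qquad \lambda_j(y):=s+z_j(y),\qquad s=\sum_{i=1}^Ng_iy_i.$$ In particular $\lambda_j>0$, and $\lambda_j-\lambda_k=z_j-z_k$ for all $j,k$.
   Context: The Maxwell--Stefan matrix $B(y)\in\mathbb R^{N\times N}$ is $B_{ij}(y)=y_if_{ij}$ for $i\ne j$ and $B_{ii}(y)=-\sum_{\ell\ne i}f_{i\ell}y_\ell$. For $y$ in the positive cone $(0,\infty)^N$, $z_j(y)$ denotes the unique zero of $\zeta\mapsto\sum_{i=1}^Ny_i/(g_i-\zeta)$ in $(g_j,g_{j+1})$, $j=1,\dots,N-1$ (this is homogeneous of degree zero: $z_j(cy)=z_j(y)$ for $c>0$). $\nabla_yz_j\in\mathbb R^N$ is the Euclidean gradient of this function on the positive cone. *)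

theory Defs
  imports "HOL-Analysis.Analysis"
begin

text \<open>
  Vectors in $R^N$ have type \<open>real ^ 'n\<close> with \<open>N = CARD('n)\<close>. The index type is finite and
  linearly ordered, so its elements play the role of $1 < 2 < \dots < N$; an index \<open>j\<close> is one of
  $1, \dots, N-1$ iff \<open>j < Max UNIV\<close>.
\<close>

definition succ_index :: "'n::{finite,linorder} \<Rightarrow> 'n" where
  "succ_index j = Min {i. j < i}"

definition open_simplex :: "(real ^ 'n) set" where
  "open_simplex = {y. (\<forall>i. 0 < y $ i \<and> y $ i < 1) \<and> (\<Sum>i\<in>UNIV. y $ i) = 1}"

text \<open>The values \<open>f i i\<close> do not enter.\<close>

definition ms_matrix :: "('n \<Rightarrow> 'n \<Rightarrow> real) \<Rightarrow> real ^ 'n \<Rightarrow> real ^ 'n ^ 'n" where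
  "ms_matrix f y =
     (\<chi> i j. if i = j then - (\<Sum>l\<in>UNIV - {i}. f i l * y $ l) else y $ i * f i j)"

text \<open>
  The defining property has a unique solution for strictly increasing \<open>g\<close>, \<open>j < Max UNIV\<close> and \<open>y\<close>
  in the positive cone. That cone is open, so derivatives at its points do not depend on the
  arbitrary values taken elsewhere.
\<close>

definition ms_zero :: "real ^ 'n::{finite,linorder} \<Rightarrow> 'n \<Rightarrow> real ^ 'n::{finite,linorder} \<Rightarrow> real" where
  "ms_zero g j y =
     (THE \<zeta>. g $ j < \<zeta> \<and> \<zeta> < g $ succ_index j \<and> (\<Sum>i\<in>UNIV. y $ i / (g $ i - \<zeta>)) = 0)"

definition ms_lambda :: "real ^ 'n::{finite,linorder} \<Rightarrow> 'n \<Rightarrow> real ^ 'n::{finite,linorder} \<Rightarrow> real" where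
  "ms_lambda g j y = (\<Sum>i\<in>UNIV. g $ i * y $ i) + ms_zero g j y"

text \<open>Meaningful only where \<open>h\<close> is differentiable.\<close>

definition gradient :: "('a::euclidean_space \<Rightarrow> real) \<Rightarrow> 'a \<Rightarrow> 'a" where
  "gradient h x = (THE D. GDERIV h x :> D)"

end

theory Submission
  imports Defs
begin

text \<open>
  With $w_i = 1 / (g_i - z)$ the gradient of the zero $z$ of $\sum_i y_i / (g_i - \zeta)$ is a
  multiple of $w$, so only $B^{\sf T} w = - (s + z) w$ is needed; this follows from
  $\sum_i y_i w_i = 0$ and $g_i w_i = 1 + z w_i$. Differentiability comes without the implicit
  function theorem: subtracting the equations for $z(x)$ and $z(y)$ gives the exact formula
  $z(x) - z(y) = - \langle x - y, w \rangle / S(x)$, where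
  $S(x) = \sum_i x_i / ((g_i - z(x)) (g_i - z(y)))$ is continuous at $y$ as soon as $z$ is.
\<close>

section \<open>The secular function between consecutive poles\<close>

definition secular :: "real ^ 'n \<Rightarrow> real ^ 'n \<Rightarrow> real \<Rightarrow> real" where
  "secular g x \<zeta> = (\<Sum>i\<in>UNIV. x $ i / (g $ i - \<zeta>))"

text \<open>A pole outside the open interval sees both points on the same side, so the two factors
  share their sign. Both strict monotonicity and the positivity of \<open>S\<close> rest on
  this.\<close>

lemma gap_product_pos:
  fixes a b p u v :: real
  assumes "p \<le> a \<or> b \<le> p" "a < u" "u < b" "a < v" "v < b"
  shows "0 < (p - u) * (p - v)"
  using assms by (auto simp: zero_less_mult_iff)

lemma gap_avoid:
  fixes g :: "real ^ 'n"
  assumes "\<forall>i. g $ i \<le> a \<or> b \<le> g $ i" "u \<in> {a<..<b}"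
  shows "\<forall>i. g $ i \<noteq> u"
  using assms by (metis greaterThanLessThan_iff linorder_not_less)

text \<open>An exact difference quotient. Its sign gives monotonicity, and its value, at the two
  zeros, becomes the denominator \<open>S\<close> in the increment formula.\<close>

lemma secular_diff:
  assumes "\<forall>i. g $ i \<noteq> u" "\<forall>i. g $ i \<noteq> v"
  shows "secular g x v - secular g x u =
    (v - u) * (\<Sum>i\<in>UNIV. x $ i / ((g $ i - v) * (g $ i - u)))"
proof -
  have "x $ i / (g $ i - v) - x $ i / (g $ i - u) =
      (v - u) * (x $ i / ((g $ i - v) * (g $ i - u)))" for i
  proof -
    have "g $ i - u \<noteq> 0" "g $ i - v \<noteq> 0"
      using assms by auto
    then show ?thesis
      by (simp add: diff_frac_eq) (simp add: algebra_simps)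
  qed
  then show ?thesis
    by (simp add: secular_def sum_distrib_left flip: sum_subtractf)
qed

lemma secular_strict_mono_on:
  assumes gap: "\<forall>i. g $ i \<le> a \<or> b \<le> g $ i" and x: "\<forall>i. 0 < x $ i"
  shows "strict_mono_on {a<..<b} (secular g x)"
proof (rule strict_mono_onI)
  fix u v assume uv: "u \<in> {a<..<b}" "v \<in> {a<..<b}" "u < v"
  have "0 < (\<Sum>i\<in>UNIV. x $ i / ((g $ i - v) * (g $ i - u)))"
    using uv gap x by (intro sum_pos divide_pos_pos gap_product_pos[of _ a b]) auto
  moreover have "\<forall>i. g $ i \<noteq> u" "\<forall>i. g $ i \<noteq> v"
    using gap_avoid[OF gap] uv by blast+
  ultimately show "secular g x u < secular g x v"
    using secular_diff[of g u v x] uv(3) by (smt (verit) mult_pos_pos)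
qed

text \<open>
  Multiplying by $(\zeta - g_j) (g_k - \zeta)$ removes the two poles bounding the gap, which makes
  the intermediate value theorem applicable on the closed interval.
\<close>

lemma secular_zero_exists:
  fixes g x :: "real ^ 'n"
  assumes gap: "\<forall>i. i \<noteq> j \<and> i \<noteq> k \<longrightarrow> g $ i < g $ j \<or> g $ k < g $ i"
    and jk: "g $ j < g $ k" and x: "0 < x $ j" "0 < x $ k"
  shows "\<exists>\<zeta>. g $ j < \<zeta> \<and> \<zeta> < g $ k \<and> secular g x \<zeta> = 0"
proof -
  define R where "R \<zeta> = (\<Sum>i\<in>UNIV - {j, k}. x $ i / (g $ i - \<zeta>))" for \<zeta>
  define G where "G \<zeta> = x $ k * (\<zeta> - g $ j) - x $ j * (g $ k - \<zeta>) +
    (\<zeta> - g $ j) * (g $ k - \<zeta>) * R \<zeta>" for \<zeta>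
  have "continuous_on {g $ j..g $ k} R"
    unfolding R_def using gap by (intro continuous_intros) force
  then have "continuous_on {g $ j..g $ k} G"
    unfolding G_def by (intro continuous_intros)
  \<comment> \<open>At either endpoint a single term of \<open>G\<close> survives:
    \<open>- x $ j * (g $ k - g $ j)\<close> on the left and \<open>x $ k * (g $ k - g $ j)\<close>
    on the right. The strict signs also keep the root off the endpoints.\<close>
  moreover have ends: "G (g $ j) < 0" "0 < G (g $ k)"
    using jk x by (simp_all add: G_def)
  ultimately obtain \<zeta> where \<zeta>: "g $ j \<le> \<zeta>" "\<zeta> \<le> g $ k" "G \<zeta> = 0"
    using IVT'[of G "g $ j" 0 "g $ k"] jk by auto
  with ends have strict: "g $ j < \<zeta>" "\<zeta> < g $ k"
    by (auto simp: order_less_le)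
  define h where "h i = x $ i / (g $ i - \<zeta>)" for i
  have "sum h UNIV = h j + sum h (UNIV - {j})"
    by (rule sum.remove) auto
  also have "sum h (UNIV - {j}) = h k + sum h (UNIV - {j} - {k})"
    using jk by (intro sum.remove) auto
  also have "UNIV - {j} - {k} = UNIV - {j, k}"
    by auto
  finally have split: "secular g x \<zeta> = x $ j / (g $ j - \<zeta>) + (x $ k / (g $ k - \<zeta>) + R \<zeta>)"
    by (simp only: secular_def R_def h_def)
  have "(\<zeta> - g $ j) * (g $ k - \<zeta>) * secular g x \<zeta> = G \<zeta>"
  proof -
    have "(\<zeta> - g $ j) * (x $ j / (g $ j - \<zeta>)) = - x $ j" "(g $ k - \<zeta>) * (x $ k / (g $ k - \<zeta>)) = x $ k"
      using strict by (simp_all add: field_simps)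
    then show ?thesis
      unfolding split G_def by algebra
  qed
  with \<zeta> strict show ?thesis by auto
qed

section \<open>Continuity and differentiability of the zero\<close>

lemma tendsto_secular:
  assumes "\<forall>i. g $ i \<noteq> \<zeta>"
  shows "((\<lambda>x. secular g x \<zeta>) \<longlongrightarrow> secular g y \<zeta>) (nhds y)"
  unfolding secular_def using assms by (auto intro!: tendsto_intros filterlim_ident)

lemma eventually_positive:
  fixes y :: "real ^ 'n"
  assumes "\<forall>i. 0 < y $ i"
  shows "\<forall>\<^sub>F x in nhds y. \<forall>i. 0 < x $ i"
proof -
  have "\<forall>\<^sub>F x in nhds y. 0 < x $ i" for i
    using assms by (intro order_tendstoD(1)[where y = "y $ i"] tendsto_intros filterlim_ident) auto
  then show ?thesis by (simp add: eventually_all_finite)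
qed

text \<open>By monotonicity, the position of \<open>z x\<close> relative to a fixed point
  \<open>u\<close> of the gap is read off from the sign of \<open>secular g x u\<close>. At fixed
  \<open>u\<close> this value is continuous in \<open>x\<close>, so its nonzero sign at
  \<open>y\<close> persists nearby.\<close>

lemma secular_zero_continuous:
  fixes g y :: "real ^ 'n"
  assumes gap: "\<forall>i. g $ i \<le> a \<or> b \<le> g $ i" and y: "\<forall>i. 0 < y $ i"
    and z: "\<And>x. \<forall>i. 0 < x $ i \<Longrightarrow> z x \<in> {a<..<b} \<and> secular g x (z x) = 0"
  shows "(z \<longlongrightarrow> z y) (nhds y)"
proof (rule order_tendstoI)
  note mono = secular_strict_mono_on[OF gap]
  fix c assume c: "c < z y"
  \<comment> \<open>The bound \<open>c\<close> may lie outside the gap; taking the maximum with a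
    midpoint yields a point of the gap that is at least \<open>c\<close> and still below
    \<open>z y\<close>.\<close>
  define u where "u = max c ((a + z y) / 2)"
  have u: "u \<in> {a<..<b}" "u < z y" "c \<le> u"
    using c z[OF y] by (auto simp: u_def max_def min_def)
  have "secular g y u < 0"
    using strict_mono_onD[OF mono[OF y] u(1) _ u(2)] z[OF y] by simp
  moreover have "\<forall>i. g $ i \<noteq> u" using gap_avoid[OF gap u(1)] .
  ultimately have "\<forall>\<^sub>F x in nhds y. secular g x u < 0"
    by (intro order_tendstoD(2)[OF tendsto_secular])
  with eventually_positive[OF y] show "\<forall>\<^sub>F x in nhds y. c < z x"
  proof eventually_elim
    case (elim x)
    then have "u < z x"
      using strict_mono_on_less[OF mono, of x u "z x"] u z[of x] by auto
    with u show ?case by simp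
  qed
next
  note mono = secular_strict_mono_on[OF gap]
  fix c assume c: "z y < c"
  define u where "u = min c ((b + z y) / 2)"
  have u: "u \<in> {a<..<b}" "z y < u" "u \<le> c"
    using c z[OF y] by (auto simp: u_def max_def min_def)
  have "0 < secular g y u"
    using strict_mono_onD[OF mono[OF y] _ u(1) u(2)] z[OF y] by simp
  moreover have "\<forall>i. g $ i \<noteq> u" using gap_avoid[OF gap u(1)] .
  ultimately have "\<forall>\<^sub>F x in nhds y. 0 < secular g x u"
    by (intro order_tendstoD(1)[OF tendsto_secular])
  with eventually_positive[OF y] show "\<forall>\<^sub>F x in nhds y. z x < c"
  proof eventually_elim
    case (elim x)
    then have "z x < u"
      using strict_mono_on_less[OF mono, of x "z x" u] u z[of x] by auto
    with u show ?case by simp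
  qed
qed

text \<open>Caratheodory's criterion: an exact increment with a slope \<open>D\<close> continuous at
  \<open>y\<close>. By Cauchy-Schwarz the relative error is at most
  \<open>norm (D x - D y)\<close>.\<close>

lemma GDERIV_Caratheodory:
  fixes h :: "'a::real_inner \<Rightarrow> real"
  assumes eq: "\<forall>\<^sub>F x in nhds y. h x - h y = (x - y) \<bullet> D x" and D: "(D \<longlongrightarrow> D y) (nhds y)"
  shows "GDERIV h y :> D y"
  unfolding gderiv_def has_derivative_iff_norm
proof (intro conjI bounded_linear_inner_left)
  have "((\<lambda>x. norm (D x - D y)) \<longlongrightarrow> 0) (at y)"
    using D by (auto intro!: tendsto_norm_zero simp: LIM_zero_iff tendsto_nhds_iff)
  moreover have "\<forall>\<^sub>F x in at y. norm (norm (h x - h y - (x - y) \<bullet> D y) / norm (x - y)) \<le> norm (D x - D y)"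
    using eq[unfolded eventually_nhds_conv_at, THEN conjunct1] eventually_neq_at_within[of y y UNIV]
  proof eventually_elim
    case (elim x)
    then have "h x - h y - (x - y) \<bullet> D y = (x - y) \<bullet> (D x - D y)"
      by (simp add: inner_diff_right)
    then show ?case
      using elim Cauchy_Schwarz_ineq2[of "x - y" "D x - D y"] by (simp add: divide_simps mult.commute)
  qed
  ultimately show "((\<lambda>x. norm (h x - h y - (x - y) \<bullet> D y) / norm (x - y)) \<longlongrightarrow> 0) (at y)"
    by (rule Lim_null_comparison[rotated])
qed

text \<open>The factor \<open>c\<close> stays existential because the eigenvector equation is
  invariant under scaling; the proof produces \<open>- (1 / S y)\<close>.\<close>

lemma secular_zero_GDERIV:
  fixes g y :: "real ^ 'n"
  assumes gap: "\<forall>i. g $ i \<le> a \<or> b \<le> g $ i" and y: "\<forall>i. 0 < y $ i"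
    and z: "\<And>x. \<forall>i. 0 < x $ i \<Longrightarrow> z x \<in> {a<..<b} \<and> secular g x (z x) = 0"
  shows "\<exists>c. GDERIV z y :> c *\<^sub>R (\<chi> i. 1 / (g $ i - z y))"
proof -
  define w where "w = (\<chi> i. 1 / (g $ i - z y))"
  define S where "S x = (\<Sum>i\<in>UNIV. x $ i / ((g $ i - z x) * (g $ i - z y)))" for x
  have ne: "\<forall>i. g $ i \<noteq> z x" if "\<forall>i. 0 < x $ i" for x
    using gap_avoid[OF gap] z[OF that] by blast
  have S_pos: "0 < S x" if "\<forall>i. 0 < x $ i" for x
    unfolding S_def using that z[OF that] z[OF y] gap
    by (intro sum_pos divide_pos_pos gap_product_pos[of _ a b]) auto
  have "\<forall>\<^sub>F x in nhds y. z x - z y = (x - y) \<bullet> ((- (1 / S x)) *\<^sub>R w)"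
    using eventually_positive[OF y]
  proof eventually_elim
    case (elim x)
    \<comment> \<open>Here \<open>secular g x (z x)\<close> vanishes, and so does
      \<open>secular g y (z y)\<close>, which is inserted to make the right-hand side linear in
      \<open>x - y\<close>.\<close>
    have "(z x - z y) * S x = secular g y (z y) - secular g x (z y)"
      using secular_diff[OF ne[OF y] ne[OF elim], of x] z[OF elim] z[OF y] by (simp add: S_def)
    also have "\<dots> = - ((x - y) \<bullet> w)"
      by (simp add: secular_def w_def inner_vec_def diff_divide_distrib sum_subtractf)
    finally show ?case using S_pos[OF elim] by (simp add: field_simps)
  qed
  moreover have "(S \<longlongrightarrow> S y) (nhds y)"
    unfolding S_def using ne[OF y] secular_zero_continuous[OF gap y z]
    by (auto intro!: tendsto_intros filterlim_ident)
  then have "((\<lambda>x. (- (1 / S x)) *\<^sub>R w) \<longlongrightarrow> (- (1 / S y)) *\<^sub>R w) (nhds y)"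
    using S_pos[OF y] by (auto intro!: tendsto_intros filterlim_ident)
  ultimately have "GDERIV z y :> (- (1 / S y)) *\<^sub>R w"
    by (rule GDERIV_Caratheodory)
  then show ?thesis unfolding w_def by blast
qed

section \<open>Eigenvectors of the transposed Maxwell-Stefan matrix\<close>

lemma ms_matrix_transpose_eigenvector:
  fixes g y :: "real ^ 'n" and f :: "'n \<Rightarrow> 'n \<Rightarrow> real"
  assumes f: "\<forall>i j. i \<noteq> j \<longrightarrow> f i j = g $ i + g $ j" and sum_y: "(\<Sum>i\<in>UNIV. y $ i) = 1"
    and ne: "\<forall>i. g $ i \<noteq> z" and zero: "secular g y z = 0"
  defines "w \<equiv> \<chi> i. 1 / (g $ i - z)"
  shows "transpose (ms_matrix f y) *v w = (- ((\<Sum>i\<in>UNIV. g $ i * y $ i) + z)) *\<^sub>R w"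
proof (rule vec_eq_iff[THEN iffD2], rule allI)
  fix i
  define s where "s = (\<Sum>i\<in>UNIV. g $ i * y $ i)"
  have gw: "g $ k * w $ k = 1 + z * w $ k" for k
    using ne[rule_format, of k] by (simp add: w_def field_simps)
  have yw: "(\<Sum>k\<in>UNIV. y $ k * w $ k) = 0"
    using zero by (simp add: secular_def w_def)
  have "(transpose (ms_matrix f y) *v w) $ i = (\<Sum>k\<in>UNIV. ms_matrix f y $ k $ i * w $ k)"
    by (simp add: matrix_vector_mult_def transpose_def)
  also have "\<dots> = ms_matrix f y $ i $ i * w $ i + (\<Sum>k\<in>UNIV - {i}. ms_matrix f y $ k $ i * w $ k)"
    by (rule sum.remove) auto
  \<comment> \<open>The diagonal entry is minus the sum of the off-diagonal entries of column
    \<open>i\<close>, by symmetry of \<open>f\<close>, so it turns each \<open>w $ k\<close> into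
    \<open>w $ k - w $ i\<close>. The term \<open>k = i\<close> then vanishes, which lets the sum
    run over all indices.\<close>
  also have "\<dots> = (\<Sum>k\<in>UNIV - {i}. y $ k * (g $ i + g $ k) * (w $ k - w $ i))"
    using f by (simp add: ms_matrix_def sum_distrib_left sum_negf sum_subtractf algebra_simps)
  also have "\<dots> = (\<Sum>k\<in>UNIV. y $ k * (g $ i + g $ k) * (w $ k - w $ i))"
    by (rule sum.mono_neutral_left) auto
  also have "\<dots> = (\<Sum>k\<in>UNIV. g $ i * (y $ k * w $ k) + y $ k * (g $ k * w $ k)
      - g $ i * w $ i * y $ k - w $ i * (g $ k * y $ k))"
    by (rule sum.cong) (simp_all add: algebra_simps)
  also have "\<dots> = (\<Sum>k\<in>UNIV. y $ k * (g $ k * w $ k)) - g $ i * w $ i - w $ i * s"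
    by (simp add: sum.distrib sum_subtractf yw sum_y s_def flip: sum_distrib_left)
  also have "(\<Sum>k\<in>UNIV. y $ k * (g $ k * w $ k)) = (\<Sum>k\<in>UNIV. y $ k + z * (y $ k * w $ k))"
    unfolding gw by (simp add: algebra_simps)
  also have "\<dots> = 1"
    by (simp add: sum.distrib yw sum_y flip: sum_distrib_left)
  finally show "(transpose (ms_matrix f y) *v w) $ i =
      ((- ((\<Sum>i\<in>UNIV. g $ i * y $ i) + z)) *\<^sub>R w) $ i"
    unfolding gw s_def by (simp add: algebra_simps)
qed

section \<open>The indexed zeros and the final assembly\<close>

lemma less_succ_index:
  assumes "j < Max UNIV"
  shows "j < succ_index j"
proof -
  have "Min {i. j < i} \<in> {i. j < i}"
    using assms by (intro Min_in) auto
  then show ?thesis by (simp add: succ_index_def)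
qed

lemma succ_index_le:
  assumes "j < i"
  shows "succ_index j \<le> i"
  using assms by (simp add: succ_index_def)

text \<open>No index lies strictly between \<open>j\<close> and its successor, so the interval
  contains no pole. The intermediate value argument then gives existence and strict monotonicity
  gives uniqueness, which justifies the definite description.\<close>

lemma ms_zero_props:
  fixes g x :: "real ^ 'n::{finite,linorder}"
  assumes mono: "strict_mono (($) g)" and j: "j < Max UNIV" and x: "\<forall>i. 0 < x $ i"
  shows "ms_zero g j x \<in> {g $ j<..<g $ succ_index j}" "secular g x (ms_zero g j x) = 0"
proof -
  define k where "k = succ_index j"
  have gap: "i \<le> j \<or> k \<le> i" for i
    using succ_index_le[of j i] by (auto simp: k_def simp flip: not_less)
  then have "\<forall>i. i \<noteq> j \<and> i \<noteq> k \<longrightarrow> g $ i < g $ j \<or> g $ k < g $ i"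
    using mono by (metis order_le_imp_less_or_eq strict_mono_less)
  moreover have "g $ j < g $ k"
    using less_succ_index[OF j] mono by (simp add: k_def strict_monoD)
  ultimately have ex: "\<exists>\<zeta>. \<zeta> \<in> {g $ j<..<g $ k} \<and> secular g x \<zeta> = 0"
    using secular_zero_exists[of j k g x] x by auto
  have "\<forall>i. g $ i \<le> g $ j \<or> g $ k \<le> g $ i"
    using gap mono by (simp add: strict_mono_less_eq)
  then have inj: "inj_on (secular g x) {g $ j<..<g $ k}"
    using secular_strict_mono_on x by (intro strict_mono_on_imp_inj_on) blast
  have "\<exists>!\<zeta>. \<zeta> \<in> {g $ j<..<g $ k} \<and> secular g x \<zeta> = 0"
    using ex inj by (metis inj_onD)
  from theI'[OF this] show "ms_zero g j x \<in> {g $ j<..<g $ succ_index j}" "secular g x (ms_zero g j x) = 0"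
    by (simp_all add: ms_zero_def secular_def k_def conj_assoc)
qed

lemma gradient_eqI:
  fixes h :: "'a::euclidean_space \<Rightarrow> real"
  assumes "GDERIV h x :> D"
  shows "gradient h x = D"
  unfolding gradient_def
proof (rule the_equality)
  show "GDERIV h x :> D" by (fact assms)
next
  fix E assume "GDERIV h x :> E"
  then have "(\<lambda>v. v \<bullet> E) = (\<lambda>v. v \<bullet> D)"
    using assms unfolding gderiv_def by (rule has_derivative_unique)
  then show "E = D"
    by (metis inner_commute vector_eq_rdot)
qed

theorem lemma4p8:
  fixes g y :: "real ^ 'n::{finite,linorder}" and f :: "'n \<Rightarrow> 'n \<Rightarrow> real"
  assumes "CARD('n) \<ge> 2"
    and "\<forall>i. 0 < g $ i" and "strict_mono (($) g)"
    and "\<forall>i j. i \<noteq> j \<longrightarrow> f i j = g $ i + g $ j"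
    and "y \<in> open_simplex"
  shows "(\<forall>j < Max UNIV.
            GDERIV (ms_zero g j) y :> gradient (ms_zero g j) y \<and>
            transpose (ms_matrix f y) *v gradient (ms_zero g j) y =
              (- ms_lambda g j y) *\<^sub>R gradient (ms_zero g j) y \<and>
            0 < ms_lambda g j y) \<and>
         (\<forall>j < Max UNIV. \<forall>k < Max UNIV.
            ms_lambda g j y - ms_lambda g k y = ms_zero g j y - ms_zero g k y)"
proof (intro conjI allI impI)
  have y: "\<forall>i. 0 < y $ i" and sum_y: "(\<Sum>i\<in>UNIV. y $ i) = 1"
    using assms(5) by (auto simp: open_simplex_def)
  fix j :: 'n assume j: "j < Max UNIV"
  let ?z = "ms_zero g j"
  define w where "w = (\<chi> i. 1 / (g $ i - ?z y))"
  note props = ms_zero_props[OF assms(3) j]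
  have gap: "\<forall>i. g $ i \<le> g $ j \<or> g $ succ_index j \<le> g $ i"
    using assms(3) succ_index_le[of j] by (metis linorder_not_less strict_mono_less_eq)
  obtain c where c: "GDERIV ?z y :> c *\<^sub>R w"
    using secular_zero_GDERIV[OF gap y, of ?z] props unfolding w_def by blast
  then show "GDERIV ?z y :> gradient ?z y"
    by (simp add: gradient_eqI)
  have "\<forall>i. g $ i \<noteq> ?z y"
    using gap_avoid[OF gap props(1)[OF y]] .
  then have "transpose (ms_matrix f y) *v w = (- ms_lambda g j y) *\<^sub>R w"
    using ms_matrix_transpose_eigenvector[OF assms(4) sum_y _ props(2)[OF y]]
    by (simp add: w_def ms_lambda_def)
  then show "transpose (ms_matrix f y) *v gradient ?z y = (- ms_lambda g j y) *\<^sub>R gradient ?z y"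
    by (simp add: gradient_eqI[OF c] matrix_vector_mult_scaleR)
  have "0 < (\<Sum>i\<in>UNIV. g $ i * y $ i)"
    using assms(2) y by (intro sum_pos) auto
  \<comment> \<open>The zero exceeds \<open>g $ j\<close>, which is positive.\<close>
  moreover have "0 < ?z y"
    using props(1)[OF y] assms(2)[rule_format, of j] by simp
  ultimately show "0 < ms_lambda g j y"
    by (simp add: ms_lambda_def)
qed (simp add: ms_lambda_def)

end
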